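(* Let $k$ be a field and let $I$ be a monomial ideal of $R=k[x_1,\ldots,x_n]$. Suppose $M_1,\ldots,M_q$ are monomials that form a minimal generating set for $I$, and that the polarization $\mathcal{P}(I)$ is the facet ideal of a simplicial complex $\Delta$. Assume that $\Delta$ has a leaf which has a joint corresponding to the monomial $\mathcal{P}(M_1)$. Let $I'=(M_2,\ldots,M_q)$. Then $$\operatorname{height} I=\operatorname{height} I'.$$
   Context: Polarization: for a monomial $M=x_1^{a_1}\cdots x_n^{a_n}$ put $\mathcal{P}(M)=\prod_{i=1}^n\prod_{j=1}^{a_i}x_{i,j}$, a square-free monomial in a polynomial ring $S=k[x_{i,j}]$ with sufficiently many variables. For a monomial ideal $I=(M_1,\ldots,M_q)$, $\mathcal{P}(I)=(\mathcal{P}(M_1),\ldots,\mathcal{P}(M_q))\subseteq S$. Facet ideals: a simplicial complex $\Delta$ is a collection of subsets (faces) of a finite vertex set, closed under taking subsets and containing all singletons of vertices; facets are its maximal faces. Vertices are identified with variables of a polynomial ring, and the facet ideal $\mathcal{F}(\Delta)$ is the ideal generated by the square-free monomials $\prod_{v\in F}v$, $F$ a facet of $\Delta$. Thus the facets of $\Delta$ correspond to the minimal monomial generators of $\mathcal{F}(\Delta)$. Leaf and joint: a facet $F$ of $\Delta$ is a leaf if either $F$ is the only facet of $\Delta$, or there is a facet $G\neq F$ of $\Delta$ such that $F\cap H\subseteq G$ for every facet $H\ne F$ of $\Delta$. Such a facet $G$ is called a joint of the leaf $F$ if moreover $F\cap G\neq\emptyset$. *)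

theory Defs
  imports
    "HOL-Library.Poly_Mapping"
    "HOL-Library.Extended_Nat"
    "HOL-Algebra.Ideal"
begin

section \<open>Polynomial rings\<close>

text \<open>
  A polynomial over \<open>'k\<close> is a finitely supported map from exponent vectors to coefficients.
  The type \<open>'v\<close> only supplies names of variables; the set \<open>V\<close> of variables of the ring
  $k[x_v : v \in V]$ is explicit, so that the number of variables can be an arbitrary natural number.
\<close>

type_synonym ('v, 'k) mpoly = "('v \<Rightarrow>\<^sub>0 nat) \<Rightarrow>\<^sub>0 'k"

definition poly_ring :: "'v set \<Rightarrow> ('v, 'k::field) mpoly ring" where
  "poly_ring V =
     \<lparr> carrier = {p. \<forall>a\<in>Poly_Mapping.keys p. Poly_Mapping.keys a \<subseteq> V},
       mult = (*), one = 1, zero = 0, add = (+) \<rparr>"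

text \<open>\<open>monomial a\<close> is $\prod_v x_v^{a_v}$, with coefficient 1.\<close>

definition monomial :: "('v \<Rightarrow>\<^sub>0 nat) \<Rightarrow> ('v, 'k::field) mpoly" where
  "monomial a = Poly_Mapping.single a 1"

definition var :: "'v \<Rightarrow> ('v, 'k::field) mpoly" where
  "var v = monomial (Poly_Mapping.single v 1)"

lemma cring_poly_ring: "cring (poly_ring V :: ('v, 'k::field) mpoly ring)"
proof (rule cringI)
  let ?C = "{p :: ('v, 'k) mpoly. \<forall>a\<in>Poly_Mapping.keys p. Poly_Mapping.keys a \<subseteq> V}"
  have add: "p + q \<in> ?C" if "p \<in> ?C" "q \<in> ?C" for p q
  proof (rule CollectI, rule ballI)
    fix a assume "a \<in> Poly_Mapping.keys (p + q)"
    then have "a \<in> Poly_Mapping.keys p \<union> Poly_Mapping.keys q"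
      using keys_add[of p q] by (rule subsetD[rotated])
    then show "Poly_Mapping.keys a \<subseteq> V"
      using that by (elim UnE) simp_all
  qed
  have mult: "p * q \<in> ?C" if "p \<in> ?C" "q \<in> ?C" for p q
  proof (rule CollectI, rule ballI)
    fix a assume "a \<in> Poly_Mapping.keys (p * q)"
    then have "a \<in> {b + c |b c. b \<in> Poly_Mapping.keys p \<and> c \<in> Poly_Mapping.keys q}"
      using keys_mult[of p q] by (rule subsetD[rotated])
    then obtain b c where a: "a = b + c"
      and bc: "b \<in> Poly_Mapping.keys p" "c \<in> Poly_Mapping.keys q"
      by (elim CollectE exE conjE)
    have "Poly_Mapping.keys b \<subseteq> V" "Poly_Mapping.keys c \<subseteq> V"
      using that bc by simp_all
    then show "Poly_Mapping.keys a \<subseteq> V"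
      unfolding a using keys_add[of b c] by (meson Un_least subset_trans)
  qed
  have minus: "\<exists>q\<in>?C. q + p = 0" if "p \<in> ?C" for p
    using that by (intro bexI[of _ "- p"]) simp_all
  have zero_one: "0 \<in> ?C" "1 \<in> ?C"
    by simp_all
  have R: "carrier (poly_ring V) = ?C" "(\<oplus>\<^bsub>poly_ring V\<^esub>) = ((+) :: ('v, 'k) mpoly \<Rightarrow> _)"
    "(\<otimes>\<^bsub>poly_ring V\<^esub>) = ((*) :: ('v, 'k) mpoly \<Rightarrow> _)"
    "\<zero>\<^bsub>poly_ring V\<^esub> = (0 :: ('v, 'k) mpoly)" "\<one>\<^bsub>poly_ring V\<^esub> = (1 :: ('v, 'k) mpoly)"
    by (simp_all add: poly_ring_def)
  show "abelian_group (poly_ring V :: ('v, 'k) mpoly ring)"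
    by (rule abelian_groupI; unfold R)
      (rule add zero_one add.assoc add.commute add_0 minus; assumption)+
  show "Group.comm_monoid (poly_ring V :: ('v, 'k) mpoly ring)"
    by (rule comm_monoidI; unfold R)
      (rule mult zero_one mult.assoc mult.commute mult_1; assumption)+
qed (simp add: poly_ring_def distrib_right)

section \<open>Ideals\<close>

definition monomial_ideal :: "('v, 'k::field) mpoly ring \<Rightarrow> ('v, 'k) mpoly set \<Rightarrow> bool" where
  "monomial_ideal R I \<longleftrightarrow> (\<exists>A. monomial ` A \<subseteq> carrier R \<and> I = Idl\<^bsub>R\<^esub> (monomial ` A))"

text \<open>No proper subfamily generates \<open>I\<close>; in particular \<open>g\<close> is injective on \<open>J\<close>.\<close>

definition minimally_generates :: "'a ring \<Rightarrow> 'i set \<Rightarrow> ('i \<Rightarrow> 'a) \<Rightarrow> 'a set \<Rightarrow> bool" where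
  "minimally_generates R J g I \<longleftrightarrow>
     g ` J \<subseteq> carrier R \<and> Idl\<^bsub>R\<^esub> (g ` J) = I \<and> (\<forall>J'. J' \<subset> J \<longrightarrow> Idl\<^bsub>R\<^esub> (g ` J') \<noteq> I)"

text \<open>
  The height of a prime \<open>P\<close> is the supremum of the lengths \<open>l\<close> of chains of primes
  $C_0 \subset \dots \subset C_l = P$; the height of an ideal is the infimum of the heights of
  the primes containing it (so the unit ideal has height \<open>\<infinity>\<close>).
\<close>

definition prime_height :: "'a ring \<Rightarrow> 'a set \<Rightarrow> enat" where
  "prime_height R P =
     Sup {enat l |l. \<exists>C :: nat \<Rightarrow> 'a set.
       (\<forall>i\<le>l. primeideal (C i) R) \<and> (\<forall>i<l. C i \<subset> C (Suc i)) \<and> C l = P}"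

definition height :: "'a ring \<Rightarrow> 'a set \<Rightarrow> enat" where
  "height R I = Inf {prime_height R P |P. primeideal P R \<and> I \<subseteq> P}"

section \<open>Polarization\<close>

definition polarization :: "('v \<Rightarrow>\<^sub>0 nat) \<Rightarrow> ('v \<times> nat, 'k::field) mpoly" where
  "polarization a = (\<Prod>i\<in>Poly_Mapping.keys a. \<Prod>j\<in>{1..Poly_Mapping.lookup a i}. var (i, j))"

text \<open>The polarization, in the ring \<open>S\<close>, of the ideal generated by the monomials \<open>monomial ` A\<close>.\<close>

definition polarization_ideal ::
  "('v \<times> nat, 'k::field) mpoly ring \<Rightarrow> ('v \<Rightarrow>\<^sub>0 nat) set \<Rightarrow> ('v \<times> nat, 'k) mpoly set" where
  "polarization_ideal S A = Idl\<^bsub>S\<^esub> (polarization ` A)"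

section \<open>Simplicial complexes and facet ideals\<close>

definition simplicial_complex :: "'v set \<Rightarrow> 'v set set \<Rightarrow> bool" where
  "simplicial_complex V \<Delta> \<longleftrightarrow>
     finite V \<and> \<Delta> \<subseteq> Pow V \<and> (\<forall>F\<in>\<Delta>. \<forall>G. G \<subseteq> F \<longrightarrow> G \<in> \<Delta>) \<and> (\<forall>v\<in>V. {v} \<in> \<Delta>)"

definition facets :: "'v set set \<Rightarrow> 'v set set" where
  "facets \<Delta> = {F \<in> \<Delta>. \<forall>G\<in>\<Delta>. F \<subseteq> G \<longrightarrow> G = F}"

definition facet_monomial :: "'v set \<Rightarrow> ('v, 'k::field) mpoly" where
  "facet_monomial F = (\<Prod>v\<in>F. var v)"

definition facet_ideal :: "('v, 'k::field) mpoly ring \<Rightarrow> 'v set set \<Rightarrow> ('v, 'k) mpoly set" where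
  "facet_ideal S \<Delta> = Idl\<^bsub>S\<^esub> (facet_monomial ` facets \<Delta>)"

definition leaf :: "'v set set \<Rightarrow> 'v set \<Rightarrow> bool" where
  "leaf \<Delta> F \<longleftrightarrow> F \<in> facets \<Delta> \<and>
     (facets \<Delta> = {F} \<or>
      (\<exists>G\<in>facets \<Delta>. G \<noteq> F \<and> (\<forall>H\<in>facets \<Delta>. H \<noteq> F \<longrightarrow> F \<inter> H \<subseteq> G)))"

definition joint :: "'v set set \<Rightarrow> 'v set \<Rightarrow> 'v set \<Rightarrow> bool" where
  "joint \<Delta> F G \<longleftrightarrow> leaf \<Delta> F \<and> G \<in> facets \<Delta> \<and> G \<noteq> F \<and>
     (\<forall>H\<in>facets \<Delta>. H \<noteq> F \<longrightarrow> F \<inter> H \<subseteq> G) \<and> F \<inter> G \<noteq> {}"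

end

theory Submission
  imports Defs "HOL-Algebra.QuotRing" "HOL-Combinatorics.Transposition"
begin

text \<open>
  Let $P$ be a prime containing $I'$, and let the leaf $F$ correspond to $M_j$. Then $P$ contains
  a variable $x_v$ dividing $M_j$. If $x_v$ divides $M_1$, then $I \subseteq P$. Otherwise
  $x_{v,1} \in F \setminus G$, so by the leaf condition $x_v$ divides no generator other than $M_j$;
  since $F \cap G \ne \emptyset$, some $x_w$ divides both $M_1$ and $M_j$. The automorphism of $R$
  that swaps $x_v$ and $x_w$ then maps $P$ to a prime of the same height which contains $I$.
\<close>

section \<open>Heights\<close>

lemma height_mono: "I \<subseteq> J \<Longrightarrow> height R I \<le> height R J"
  unfolding height_def by (rule Inf_superset_mono) auto

lemma primeideal_vimage:
  assumes "cring R" "cring S" "h \<in> ring_hom R S" "primeideal P S"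
  shows "primeideal {x \<in> carrier R. h x \<in> P} R"
proof -
  interpret R: cring R by fact
  interpret S: cring S by fact
  interpret P: primeideal P S by fact
  interpret h: ring_hom_ring R S h
    by (rule ring_hom_ringI2) (use assms in \<open>simp_all add: R.ring_axioms S.ring_axioms\<close>)
  show ?thesis
  proof (rule primeidealI)
    show "ideal {x \<in> carrier R. h x \<in> P} R"
      by (rule h.ideal_vimage[OF P.is_ideal])
    show "carrier R \<noteq> {x \<in> carrier R. h x \<in> P}"
    proof
      assume "carrier R = {x \<in> carrier R. h x \<in> P}"
      then have "h \<one>\<^bsub>R\<^esub> \<in> P" by blast
      then show False
        using P.one_imp_carrier P.I_notcarr by simp
    qed
  qed (use P.I_prime R.is_cring in auto)
qed

text \<open>Taking preimages under an involutive endomorphism is its own inverse on primes and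
  preserves strict inclusion. A chain of primes ending in the preimage of \<open>P\<close> thus
  becomes a chain of the same length ending in \<open>P\<close>.\<close>

lemma prime_height_vimage_involution:
  assumes R: "cring R" and h: "h \<in> ring_hom R R"
    and inv: "\<And>x. x \<in> carrier R \<Longrightarrow> h (h x) = x"
    and P: "primeideal P R"
  shows "prime_height R {x \<in> carrier R. h x \<in> P} \<le> prime_height R P"
proof -
  define T where "T = (\<lambda>Q. {x \<in> carrier R. h x \<in> Q})"
  have hc: "h x \<in> carrier R" if "x \<in> carrier R" for x
    using h that by (auto simp: ring_hom_def)
  have TT: "T (T Q) = Q" if "primeideal Q R" for Q
  proof -
    interpret Q: primeideal Q R by fact
    show ?thesis
      unfolding T_def using Q.a_subset inv hc by auto
  qed
  have T_mono: "T A \<subset> T B" if "primeideal A R" "primeideal B R" "A \<subset> B" for A B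
  proof -
    have "T A \<subseteq> T B" using that(3) by (auto simp: T_def)
    moreover have "T A \<noteq> T B" using TT that by (metis psubset_eq)
    ultimately show ?thesis by blast
  qed
  have "prime_height R (T P) \<le> prime_height R P"
    unfolding prime_height_def
  proof (rule Sup_subset_mono, clarify)
    fix l and C :: "nat \<Rightarrow> 'a set"
    assume C: "\<forall>i\<le>l. primeideal (C i) R" "\<forall>i<l. C i \<subset> C (Suc i)" "C l = T P"
    show "\<exists>l'. enat l = enat l' \<and> (\<exists>C. (\<forall>i\<le>l'. primeideal (C i) R) \<and>
      (\<forall>i<l'. C i \<subset> C (Suc i)) \<and> C l' = P)"
    proof (intro exI conjI allI impI)
      show "enat l = enat l" ..
      show "primeideal (T (C i)) R" if "i \<le> l" for i
        unfolding T_def using primeideal_vimage[OF R R h] C(1) that by blast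
      show "T (C i) \<subset> T (C (Suc i))" if "i < l" for i
        using T_mono C(1,2) that by simp
      show "T (C l) = P" using C(3) TT[OF P] by simp
    qed
  qed
  then show ?thesis by (simp add: T_def)
qed

section \<open>Monomials\<close>

text \<open>Natural numbers cannot cancel, so the inclusion \<open>keys_add\<close> becomes an
  equality.\<close>

lemma keys_plus_nat:
  "Poly_Mapping.keys (a + b) = Poly_Mapping.keys a \<union> Poly_Mapping.keys (b :: 'v \<Rightarrow>\<^sub>0 nat)"
  by (auto simp: in_keys_iff lookup_add)

text \<open>Subtraction of exponents is truncated; the pointwise comparison makes it exact.
  Divisibility of monomials is expressed in this additive form throughout.\<close>

lemma poly_mapping_le_imp_add:
  fixes a b :: "'v \<Rightarrow>\<^sub>0 nat"
  assumes "\<And>v. Poly_Mapping.lookup b v \<le> Poly_Mapping.lookup a v"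
  shows "a = b + (a - b)"
  by (rule poly_mapping_eqI) (use assms in \<open>simp add: lookup_add lookup_minus\<close>)

text \<open>Serves exponent vectors (one power of a variable at a time) as well as polynomials (one
  term at a time). The step is phrased with \<open>+\<close>, so that additive and distributive laws
  apply directly.\<close>

lemma poly_mapping_add_single_induct [case_names zero add]:
  fixes p :: "'a \<Rightarrow>\<^sub>0 'b::monoid_add"
  assumes zero: "P 0" and add: "\<And>p a c. P p \<Longrightarrow> P (p + Poly_Mapping.single a c)"
  shows "P p"
proof (induction p rule: Poly_Mapping.update_induct)
  case (update p a c)
  have "Poly_Mapping.update a c p = p + Poly_Mapping.single a c"
    by (rule poly_mapping_eqI)
      (use update(1) in \<open>auto simp: lookup_update lookup_add lookup_single in_keys_iff when_def\<close>)
  then show ?case using add[OF update(3)] by simp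
qed (fact zero)

section \<open>Monomials as ring elements, monomial ideals and their primes\<close>

lemma carrier_poly_ring:
  "p \<in> carrier (poly_ring V) \<longleftrightarrow> (\<forall>a\<in>Poly_Mapping.keys p. Poly_Mapping.keys a \<subseteq> V)"
  by (simp add: poly_ring_def)

lemma mult_poly_ring: "p \<otimes>\<^bsub>poly_ring V\<^esub> q = p * q"
  by (simp add: poly_ring_def)

lemma keys_monomial [simp]: "Poly_Mapping.keys (monomial a :: ('v, 'k::field) mpoly) = {a}"
  by (simp add: monomial_def)

lemma monomial_in_carrier [simp]:
  "(monomial a :: ('v, 'k::field) mpoly) \<in> carrier (poly_ring V) \<longleftrightarrow> Poly_Mapping.keys a \<subseteq> V"
  by (simp add: carrier_poly_ring)

lemma monomial_add: "(monomial (a + b) :: ('v, 'k::field) mpoly) = monomial a * monomial b"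
  by (simp add: monomial_def mult_single)

lemma monomial_sum:
  "(\<Prod>i\<in>A. monomial (f i)) = (monomial (\<Sum>i\<in>A. f i) :: ('v, 'k::field) mpoly)"
  by (induction A rule: infinite_finite_induct) (simp_all add: monomial_add, simp_all add: monomial_def)

lemma monomial_add_in_ideal:
  fixes J :: "('v, 'k::field) mpoly set"
  assumes "ideal J (poly_ring V)" "monomial b \<in> J" "Poly_Mapping.keys c \<subseteq> V"
  shows "monomial (b + c) \<in> J"
  using ideal.I_r_closed[OF assms(1,2), of "monomial c"] assms(3)
  by (simp add: monomial_add mult_poly_ring)

text \<open>The polynomials all of whose terms are divisible by some generator form an ideal
  containing the generators, hence containing the ideal they generate.\<close>

lemma keys_of_monomial_ideal:
  fixes A :: "('v \<Rightarrow>\<^sub>0 nat) set" and p :: "('v, 'k::field) mpoly"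
  assumes A: "\<Union> (Poly_Mapping.keys ` A) \<subseteq> V"
    and p: "p \<in> Idl\<^bsub>poly_ring V\<^esub> (monomial ` A)" and a: "a \<in> Poly_Mapping.keys p"
  obtains b c where "b \<in> A" "a = b + c"
proof -
  interpret R: cring "poly_ring V :: ('v, 'k) mpoly ring"
    by (rule cring_poly_ring)
  define J :: "('v, 'k) mpoly set" where
    "J = {p \<in> carrier (poly_ring V). \<forall>a\<in>Poly_Mapping.keys p. \<exists>b\<in>A. \<exists>c. a = b + c}"
  have "ideal J (poly_ring V)"
  proof (rule idealI[OF R.ring_axioms])
    show "subgroup J (add_monoid (poly_ring V))"
    proof (rule R.add.subgroupI)
      show "J \<subseteq> carrier (poly_ring V)" by (auto simp: J_def)
      show "J \<noteq> {}" by (auto simp: J_def carrier_poly_ring intro!: exI[of _ 0])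
    next
      fix p assume p: "p \<in> J"
      then have "p \<in> carrier (poly_ring V)" by (simp add: J_def)
      then have "\<ominus>\<^bsub>poly_ring V\<^esub> p = - p"
        by (intro R.minus_equality) (simp_all add: poly_ring_def)
      then show "\<ominus>\<^bsub>poly_ring V\<^esub> p \<in> J"
        using p by (simp add: J_def carrier_poly_ring)
    next
      fix p q assume pq: "p \<in> J" "q \<in> J"
      then have "p \<oplus>\<^bsub>poly_ring V\<^esub> q \<in> carrier (poly_ring V)" by (simp add: J_def)
      moreover have "p \<oplus>\<^bsub>poly_ring V\<^esub> q = p + q" by (simp add: poly_ring_def)
      ultimately show "p \<oplus>\<^bsub>poly_ring V\<^esub> q \<in> J"
        using pq keys_add[of p q] by (auto simp: J_def)
    qed
  next
    fix p x :: "('v, 'k) mpoly" assume px: "p \<in> J" "x \<in> carrier (poly_ring V)"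
    have "p * x \<in> J"
    proof -
      have "p \<otimes>\<^bsub>poly_ring V\<^esub> x \<in> carrier (poly_ring V)"
        using px by (intro R.m_closed) (simp_all add: J_def)
      moreover have "\<exists>b\<in>A. \<exists>c. a = b + c" if "a \<in> Poly_Mapping.keys (p * x)" for a
      proof -
        have "a \<in> {d + e |d e. d \<in> Poly_Mapping.keys p \<and> e \<in> Poly_Mapping.keys x}"
          using keys_mult[of p x] that by (rule subsetD)
        then obtain d e where de: "a = d + e" "d \<in> Poly_Mapping.keys p"
          by blast
        then obtain b c where "b \<in> A" "d = b + c"
          using px(1) unfolding J_def by blast
        then show ?thesis using de(1) by (auto simp: add.assoc)
      qed
      ultimately show ?thesis by (simp add: J_def mult_poly_ring)
    qed
    then show "p \<otimes>\<^bsub>poly_ring V\<^esub> x \<in> J" "x \<otimes>\<^bsub>poly_ring V\<^esub> p \<in> J"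
      by (simp_all add: mult_poly_ring mult.commute)
  qed
  moreover have "monomial ` A \<subseteq> J"
  proof
    fix p :: "('v, 'k) mpoly" assume "p \<in> monomial ` A"
    then obtain b where b: "b \<in> A" "p = monomial b" by blast
    have "\<exists>b'\<in>A. \<exists>c. b = b' + c"
      using b(1) by (intro bexI[of _ b] exI[of _ 0]) simp_all
    moreover have "Poly_Mapping.keys b \<subseteq> V" using A b(1) by blast
    ultimately show "p \<in> J"
      by (simp add: J_def b(2))
  qed
  ultimately have "p \<in> J"
    using R.genideal_minimal p by blast
  then show thesis
    using a that unfolding J_def by blast
qed

text \<open>A monomial is a finite product of variables, so a prime containing it contains a factor;
  the empty product is 1, which lies in no prime. This reduces questions about primes over monomial
  ideals to the variables they contain.\<close>

lemma monomial_in_primeideal: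
  fixes P :: "('v, 'k::field) mpoly set"
  assumes P: "primeideal P (poly_ring V)" and a: "Poly_Mapping.keys a \<subseteq> V"
  shows "monomial a \<in> P \<longleftrightarrow> (\<exists>v\<in>Poly_Mapping.keys a. var v \<in> P)"
proof
  interpret P: primeideal P "poly_ring V" by fact
  have one: "monomial 0 \<notin> P"
    using P.one_imp_carrier P.I_notcarr by (auto simp: poly_ring_def monomial_def)
  have prime: "monomial b \<in> P \<or> monomial c \<in> P"
    if "monomial (b + c) \<in> P" "Poly_Mapping.keys b \<subseteq> V" "Poly_Mapping.keys c \<subseteq> V" for b c
    using P.I_prime[of "monomial b" "monomial c"] that by (simp add: monomial_add mult_poly_ring)
  have single: "n \<noteq> 0 \<and> var v \<in> P"
    if "monomial (Poly_Mapping.single v n) \<in> P" "v \<in> V" for v n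
    using that(1)
  proof (induction n)
    case (Suc n)
    have "Poly_Mapping.single v (Suc n) = Poly_Mapping.single v 1 + Poly_Mapping.single v n"
      by (simp flip: single_add)
    then have "var v \<in> P \<or> monomial (Poly_Mapping.single v n) \<in> P"
      using prime[of "Poly_Mapping.single v 1" "Poly_Mapping.single v n"] Suc.prems \<open>v \<in> V\<close>
      by (simp add: var_def)
    then show ?case using Suc.IH by blast
  qed (use one in simp)
  show "\<exists>v\<in>Poly_Mapping.keys a. var v \<in> P" if "monomial a \<in> P"
    using that a
  proof (induction a rule: poly_mapping_add_single_induct)
    case (add a v n)
    show ?case
    \<comment> \<open>A zero exponent adds nothing; a nonzero one guarantees
      \<open>v \<in> V\<close>, which the appeal to primality requires.\<close>
    proof (cases "n = 0")
      case False
      then have "v \<in> V" using add.prems(2) by (simp add: keys_plus_nat)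
      then show ?thesis
        using prime[OF add.prems(1)] single[of v n] add False by (auto simp: keys_plus_nat)
    qed (use add in simp)
  qed (use one in simp)
  show "monomial a \<in> P" if "\<exists>v\<in>Poly_Mapping.keys a. var v \<in> P"
  proof -
    from that obtain v where v: "v \<in> Poly_Mapping.keys a" "var v \<in> P" by blast
    \<comment> \<open>As \<open>v\<close> occurs in \<open>a\<close>, one factor
      \<open>var v\<close> splits off, and the ideal absorbs the cofactor.\<close>
    have eq: "a = Poly_Mapping.single v 1 + (a - Poly_Mapping.single v 1)"
      by (rule poly_mapping_le_imp_add) (use v(1) in \<open>auto simp: lookup_single when_def in_keys_iff\<close>)
    then have "Poly_Mapping.keys (a - Poly_Mapping.single v 1) \<subseteq> V"
      using a keys_plus_nat by (metis Un_subset_iff)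
    then have "monomial (Poly_Mapping.single v 1 + (a - Poly_Mapping.single v 1)) \<in> P"
      using monomial_add_in_ideal P.is_ideal v(2) unfolding var_def by blast
    then show ?thesis using eq by simp
  qed
qed

text \<open>A generator divisible by another one could be dropped without changing the ideal,
  against minimality. The conclusion concerns indices, so repeated generators (\<open>c = 0\<close>)
  are excluded as well.\<close>

lemma minimal_monomial_generators_antichain:
  fixes M :: "'i \<Rightarrow> 'v \<Rightarrow>\<^sub>0 nat"
  assumes M: "minimally_generates (poly_ring V) J (\<lambda>i. monomial (M i) :: ('v, 'k::field) mpoly) I"
    and ij: "i \<in> J" "j \<in> J" "M i = M j + c"
  shows "i = j"
proof (rule ccontr)
  assume "i \<noteq> j"
  interpret R: cring "poly_ring V :: ('v, 'k) mpoly ring"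
    by (rule cring_poly_ring)
  let ?g = "\<lambda>i. monomial (M i) :: ('v, 'k) mpoly"
  let ?J = "J - {i}"
  have carr: "?g ` J \<subseteq> carrier (poly_ring V)" and I: "Idl\<^bsub>poly_ring V\<^esub> (?g ` J) = I"
    and min: "\<And>J'. J' \<subset> J \<Longrightarrow> Idl\<^bsub>poly_ring V\<^esub> (?g ` J') \<noteq> I"
    using M by (simp_all add: minimally_generates_def)
  have id: "ideal (Idl\<^bsub>poly_ring V\<^esub> (?g ` ?J)) (poly_ring V)"
    using carr by (intro R.genideal_ideal) blast
  have self: "?g ` ?J \<subseteq> Idl\<^bsub>poly_ring V\<^esub> (?g ` ?J)"
    using carr by (intro R.genideal_self) blast
  have "?g i \<in> carrier (poly_ring V)" using carr ij(1) by blast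
  then have "Poly_Mapping.keys (M i) \<subseteq> V" by simp
  then have "Poly_Mapping.keys c \<subseteq> V"
    by (simp add: ij(3) keys_plus_nat)
  \<comment> \<open>The generator at \<open>j\<close> survives the removal of \<open>i\<close>, and
    \<open>?g i\<close> is a multiple of it.\<close>
  then have "?g i \<in> Idl\<^bsub>poly_ring V\<^esub> (?g ` ?J)"
    unfolding ij(3) using self ij(2) \<open>i \<noteq> j\<close> by (intro monomial_add_in_ideal[OF id]) auto
  then have "?g ` J \<subseteq> Idl\<^bsub>poly_ring V\<^esub> (?g ` ?J)"
    using self by blast
  then have "I \<subseteq> Idl\<^bsub>poly_ring V\<^esub> (?g ` ?J)"
    using R.genideal_minimal[OF id] I by blast
  moreover have "Idl\<^bsub>poly_ring V\<^esub> (?g ` ?J) \<subseteq> I"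
    unfolding I[symmetric] using R.genideal_self[OF carr]
    by (intro R.genideal_minimal R.genideal_ideal[OF carr]) blast
  ultimately show False
    using min[of ?J] ij(1) by blast
qed

section \<open>Renaming variables\<close>

text \<open>\<open>map_key f\<close> precomposes with \<open>f\<close>; for an involution this moves
  the term at \<open>a\<close> to \<open>f a\<close>. Multiplication adds keys, so an additive
  \<open>f\<close> respects products of single terms, and distributivity does the rest.\<close>

lemma map_key_mult_involution:
  fixes f :: "'a::monoid_add \<Rightarrow> 'a" and p q :: "'a \<Rightarrow>\<^sub>0 'b::semiring_0"
  assumes inv: "\<And>a. f (f a) = a" and add: "\<And>a b. f (a + b) = f a + f b"
  shows "Poly_Mapping.map_key f (p * q) = Poly_Mapping.map_key f p * Poly_Mapping.map_key f q"
proof -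
  have inj: "inj f" by (metis injI inv)
  have single: "Poly_Mapping.map_key f (Poly_Mapping.single a c) = Poly_Mapping.single (f a) c"
    for a and c :: 'b
    using map_key_single[OF inj, of "f a" c] by (simp add: inv)
  have aux: "Poly_Mapping.map_key f (Poly_Mapping.single a c * q)
      = Poly_Mapping.single (f a) c * Poly_Mapping.map_key f q" for a c
    by (induction q rule: poly_mapping_add_single_induct)
      (simp_all add: inj map_key_plus distrib_left mult_single single add)
  show ?thesis
    by (induction p rule: poly_mapping_add_single_induct)
      (simp_all add: inj map_key_plus distrib_right single aux)
qed

text \<open>\<open>map_key\<close> pulls back along the transposition, which is its own inverse, so
  this agrees with renaming the variables. The same device one level up, on exponent vectors, yields
  \<open>swap_vars\<close> as an involution of polynomials.\<close>

definition swap_exponents :: "'v \<Rightarrow> 'v \<Rightarrow> ('v \<Rightarrow>\<^sub>0 nat) \<Rightarrow> ('v \<Rightarrow>\<^sub>0 nat)" where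
  "swap_exponents v w = Poly_Mapping.map_key (transpose v w)"

definition swap_vars :: "'v \<Rightarrow> 'v \<Rightarrow> ('v, 'k::field) mpoly \<Rightarrow> ('v, 'k) mpoly" where
  "swap_vars v w = Poly_Mapping.map_key (swap_exponents v w)"

lemma inj_transpose: "inj (transpose v w)"
  by (metis injI transpose_involutory)

lemma swap_exponents_involutory [simp]: "swap_exponents v w (swap_exponents v w a) = a"
  by (simp add: swap_exponents_def map_key_compose inj_transpose transpose_comp_involutory)
    (simp add: map_key_id id_def)

lemma swap_exponents_add: "swap_exponents v w (a + b) = swap_exponents v w a + swap_exponents v w b"
  by (simp add: swap_exponents_def map_key_plus inj_transpose)

lemma inj_swap_exponents: "inj (swap_exponents v w)"
  by (metis injI swap_exponents_involutory)

lemma swap_vars_involutory [simp]: "swap_vars v w (swap_vars v w p) = p"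
proof -
  have "swap_exponents v w \<circ> swap_exponents v w = (\<lambda>a. a)" by auto
  then show ?thesis
    by (simp add: swap_vars_def map_key_compose inj_swap_exponents map_key_id)
qed

lemma swap_vars_monomial: "swap_vars v w (monomial a) = monomial (swap_exponents v w a)"
  unfolding swap_vars_def monomial_def
  using map_key_single[OF inj_swap_exponents, of v w "swap_exponents v w a"] by simp

lemma swap_vars_var: "swap_vars v w (var u) = var (transpose v w u)"
  unfolding var_def swap_vars_monomial swap_exponents_def
  using map_key_single[OF inj_transpose, of v w "transpose v w u" "1::nat"]
  by (simp del: One_nat_def)

lemma swap_vars_ring_hom:
  assumes "v \<in> V" "w \<in> V"
  shows "swap_vars v w \<in> ring_hom (poly_ring V) (poly_ring V :: ('v, 'k::field) mpoly ring)"
proof (rule ring_hom_memI)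
  show "swap_vars v w p \<in> carrier (poly_ring V)" if "p \<in> carrier (poly_ring V)"
    for p :: "('v, 'k) mpoly"
    unfolding carrier_poly_ring
  proof
    fix a assume "a \<in> Poly_Mapping.keys (swap_vars v w p)"
    then have "Poly_Mapping.keys (swap_exponents v w a) \<subseteq> V"
      using that by (simp add: swap_vars_def keys_map_key inj_swap_exponents carrier_poly_ring)
    then have "transpose v w -` Poly_Mapping.keys a \<subseteq> V"
      by (simp add: swap_exponents_def keys_map_key inj_transpose)
    \<comment> \<open>Both \<open>v\<close> and \<open>w\<close> lie in \<open>V\<close>, so the
      transposition permutes \<open>V\<close>, and the inclusion of the preimage passes to the key
      set itself.\<close>
    then show "Poly_Mapping.keys a \<subseteq> V"
      using assms by (force simp: transpose_def split: if_splits)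
  qed
  show "swap_vars v w \<one>\<^bsub>poly_ring V\<^esub> = (\<one>\<^bsub>poly_ring V\<^esub> :: ('v, 'k) mpoly)"
  proof -
    have "swap_vars v w (monomial 0 :: ('v, 'k) mpoly) = monomial 0"
      by (simp add: swap_vars_monomial swap_exponents_def inj_transpose)
    then show ?thesis
      by (simp add: poly_ring_def monomial_def)
  qed
qed (simp_all add: poly_ring_def swap_vars_def map_key_plus inj_swap_exponents
    map_key_mult_involution swap_exponents_add)

section \<open>Facet monomials\<close>

text \<open>The indicator vector of \<open>F\<close>. For infinite \<open>F\<close> the sum defaults
  to 0, hence the finiteness assumptions below.\<close>

definition squarefree_exponent :: "'v set \<Rightarrow> ('v \<Rightarrow>\<^sub>0 nat)" where
  "squarefree_exponent F = (\<Sum>v\<in>F. Poly_Mapping.single v 1)"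

lemma facet_monomial_eq:
  "facet_monomial F = (monomial (squarefree_exponent F) :: ('v, 'k::field) mpoly)"
  by (simp add: facet_monomial_def var_def monomial_sum squarefree_exponent_def)

lemma keys_squarefree_exponent:
  "finite F \<Longrightarrow> Poly_Mapping.keys (squarefree_exponent F) = F"
  by (induction F rule: finite_induct) (simp_all add: squarefree_exponent_def keys_plus_nat)

lemma facet_monomial_inj:
  assumes "facet_monomial F = (facet_monomial G :: ('v, 'k::field) mpoly)" "finite F" "finite G"
  shows "F = G"
proof -
  have "squarefree_exponent F = squarefree_exponent G"
    using arg_cong[OF assms(1), of Poly_Mapping.keys] by (simp add: facet_monomial_eq)
  then show ?thesis using keys_squarefree_exponent assms(2,3) by metis
qed

text \<open>A monomial in a monomial ideal is a multiple of a generator, and divisibility of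
  square-free monomials implies inclusion of their sets of variables.\<close>

lemma facet_monomial_in_ideal:
  assumes "finite W" "\<Union> B \<subseteq> W" "finite F"
    and "(facet_monomial F :: ('v, 'k::field) mpoly) \<in> Idl\<^bsub>poly_ring W\<^esub> (facet_monomial ` B)"
  obtains K where "K \<in> B" "K \<subseteq> F"
proof -
  have fin: "finite K" if "K \<in> B" for K
    using that assms(1,2) by (meson Union_upper finite_subset)
  have "facet_monomial ` B = (monomial ` squarefree_exponent ` B :: ('v, 'k) mpoly set)"
    by (simp add: facet_monomial_eq image_image)
  then have mem: "(monomial (squarefree_exponent F) :: ('v, 'k) mpoly)
      \<in> Idl\<^bsub>poly_ring W\<^esub> (monomial ` squarefree_exponent ` B)"
    using assms(4) by (simp add: facet_monomial_eq)
  have "\<Union> (Poly_Mapping.keys ` squarefree_exponent ` B) \<subseteq> W"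
    using assms(2) fin by (auto simp: keys_squarefree_exponent)
  then obtain b c where "b \<in> squarefree_exponent ` B" "squarefree_exponent F = b + c"
    using mem by (rule keys_of_monomial_ideal[where a = "squarefree_exponent F"]) auto
  then obtain K where K: "K \<in> B" "squarefree_exponent F = squarefree_exponent K + c" by blast
  have "F = Poly_Mapping.keys (squarefree_exponent K + c)"
    using keys_squarefree_exponent[OF assms(3)] K(2) by simp
  then have "K \<subseteq> F"
    using fin[OF K(1)] by (simp add: keys_plus_nat keys_squarefree_exponent)
  then show thesis using that K(1) by blast
qed

text \<open>The set of variables of the polarized monomial, which turns polarizations into facet
  monomials. Second indices start at 1, as in the polarizing product.\<close>

definition polarization_support :: "('v \<Rightarrow>\<^sub>0 nat) \<Rightarrow> ('v \<times> nat) set" where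
  "polarization_support a = Sigma (Poly_Mapping.keys a) (\<lambda>i. {1..Poly_Mapping.lookup a i})"

lemma finite_polarization_support [simp]: "finite (polarization_support a)"
  by (simp add: polarization_support_def)

lemma polarization_eq_facet_monomial:
  "polarization a = (facet_monomial (polarization_support a) :: ('v \<times> nat, 'k::field) mpoly)"
  by (simp add: polarization_def facet_monomial_def polarization_support_def prod.Sigma)

text \<open>The first copy of a variable records whether it divides the monomial; this links
  variables of the original ring to vertices of the complex.\<close>

lemma polarization_support_one: "(v, 1) \<in> polarization_support a \<longleftrightarrow> v \<in> Poly_Mapping.keys a"
  by (auto simp: polarization_support_def in_keys_iff)

text \<open>Polarization reflects divisibility: the last copy of each variable of \<open>b\<close>
  must be among the copies present for \<open>a\<close>, which bounds its exponent.\<close>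

lemma polarization_support_subset:
  assumes "polarization_support b \<subseteq> polarization_support a"
  shows "a = b + (a - b)"
proof (rule poly_mapping_le_imp_add)
  fix v
  show "Poly_Mapping.lookup b v \<le> Poly_Mapping.lookup a v"
  proof (cases "v \<in> Poly_Mapping.keys b")
    case True
    then have "(v, Poly_Mapping.lookup b v) \<in> polarization_support b"
      by (auto simp: polarization_support_def in_keys_iff)
    then have "(v, Poly_Mapping.lookup b v) \<in> polarization_support a"
      using assms by blast
    then show ?thesis by (simp add: polarization_support_def)
  qed (simp add: in_keys_iff)
qed

text \<open>Two antichains of finite sets whose square-free monomials generate the same ideal
  coincide. Facets form an antichain by maximality, the supports by \<open>anti\<close>.\<close>

lemma polarization_supports_eq_facets:
  fixes M :: "'i \<Rightarrow> 'v \<Rightarrow>\<^sub>0 nat"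
  assumes W: "finite W" "\<Union> (facets \<Delta>) \<subseteq> W" "\<And>i. i \<in> J \<Longrightarrow> polarization_support (M i) \<subseteq> W"
    and anti: "\<And>i j c. i \<in> J \<Longrightarrow> j \<in> J \<Longrightarrow> M i = M j + c \<Longrightarrow> i = j"
    and P: "polarization_ideal (poly_ring W) (M ` J)
      = (facet_ideal (poly_ring W) \<Delta> :: ('v \<times> nat, 'k::field) mpoly set)"
  shows "(\<lambda>i. polarization_support (M i)) ` J = facets \<Delta>"
proof -
  let ?H = "\<lambda>i. polarization_support (M i)"
  let ?S = "poly_ring W :: ('v \<times> nat, 'k) mpoly ring"
  interpret S: cring ?S by (rule cring_poly_ring)
  have fin: "finite K" if "K \<in> facets \<Delta>" for K
    using that W(1,2) by (meson Union_upper finite_subset)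
  have carr: "(facet_monomial K :: ('v \<times> nat, 'k) mpoly) \<in> carrier ?S" if "K \<subseteq> W" for K
    using finite_subset[OF that W(1)] that by (simp add: facet_monomial_eq keys_squarefree_exponent)
  have P': "Idl\<^bsub>?S\<^esub> (facet_monomial ` ?H ` J) = Idl\<^bsub>?S\<^esub> (facet_monomial ` facets \<Delta>)"
    using P by (simp add: polarization_ideal_def facet_ideal_def image_image
        polarization_eq_facet_monomial)
  \<comment> \<open>Equality of the ideals is used in both directions: each support contains a
    facet, and each facet contains a support.\<close>
  have 1: "\<exists>K\<in>facets \<Delta>. K \<subseteq> ?H i" if "i \<in> J" for i
  proof -
    have "facet_monomial (?H i) \<in> Idl\<^bsub>?S\<^esub> (facet_monomial ` ?H ` J)"
      using S.genideal_self[of "facet_monomial ` ?H ` J"] carr W(3) that by blast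
    then obtain K where "K \<in> facets \<Delta>" "K \<subseteq> ?H i"
      unfolding P' by (rule facet_monomial_in_ideal[OF W(1,2) finite_polarization_support])
    then show ?thesis by blast
  qed
  have 2: "\<exists>i\<in>J. ?H i \<subseteq> K" if "K \<in> facets \<Delta>" for K
  proof -
    have "facet_monomial K \<in> Idl\<^bsub>?S\<^esub> (facet_monomial ` facets \<Delta>)"
      using S.genideal_self[of "facet_monomial ` facets \<Delta>"] carr W(2) that by blast
    moreover have HW: "\<Union> (?H ` J) \<subseteq> W" and finK: "finite K"
      using W(3) fin that by blast+
    ultimately obtain L where "L \<in> ?H ` J" "L \<subseteq> K"
      unfolding P'[symmetric] using facet_monomial_in_ideal[OF W(1) HW finK] by blast
    then show ?thesis by blast
  qed
  have "?H i \<in> facets \<Delta>" if i: "i \<in> J" for i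
  proof -
    obtain K where K: "K \<in> facets \<Delta>" "K \<subseteq> ?H i" using 1 i by blast
    obtain j where j: "j \<in> J" "?H j \<subseteq> K" using 2 K(1) by blast
    \<comment> \<open>In the sandwich \<open>?H j \<subseteq> K \<subseteq> ?H i\<close> the outer
      inclusion makes \<open>M j\<close> divide \<open>M i\<close>; with \<open>i = j\<close> it
      also forces \<open>K = ?H i\<close>.\<close>
    have "i = j"
      using anti[OF i j(1)] polarization_support_subset[of "M j" "M i"] K(2) j(2) by blast
    then show ?thesis using K j(2) by simp
  qed
  moreover have "K \<in> ?H ` J" if K: "K \<in> facets \<Delta>" for K
  proof -
    obtain j where j: "j \<in> J" "?H j \<subseteq> K" using 2 K by blast
    obtain L where L: "L \<in> facets \<Delta>" "L \<subseteq> ?H j" using 1 j(1) by blast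
    \<comment> \<open>Maximality of the facet \<open>L\<close> collapses
      \<open>L \<subseteq> ?H j \<subseteq> K\<close>.\<close>
    have "K = L" using K L j(2) by (auto simp: facets_def)
    then show ?thesis using L(2) j by blast
  qed
  ultimately show ?thesis by blast
qed

section \<open>Comparison of the primes over the two ideals\<close>

theorem theorem4p3:
  fixes n q :: nat
    and R :: "(nat, 'k::field) mpoly ring"
    and S :: "(nat \<times> nat, 'k) mpoly ring"
    and I :: "(nat, 'k) mpoly set"
    and M :: "nat \<Rightarrow> (nat \<Rightarrow>\<^sub>0 nat)"
    and W V :: "(nat \<times> nat) set"
    and \<Delta> :: "(nat \<times> nat) set set"
    and F G :: "(nat \<times> nat) set"
  assumes R: "R = poly_ring {1..n}"
    and S: "S = poly_ring W" "finite W" "W \<subseteq> {1..n} \<times> {1..}"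
    and I: "monomial_ideal R I"
    and q: "q \<ge> 1"
    and M: "minimally_generates R {1..q} (\<lambda>i. monomial (M i)) I"
    and enough_variables: "\<And>i. i \<in> {1..q} \<Longrightarrow> polarization (M i) \<in> carrier S"
    and \<Delta>: "simplicial_complex V \<Delta>" "V \<subseteq> W"
    and P: "polarization_ideal S (M ` {1..q}) = facet_ideal S \<Delta>"
    and FG: "leaf \<Delta> F" "joint \<Delta> F G"
    and G: "facet_monomial G = (polarization (M 1) :: (nat \<times> nat, 'k) mpoly)"
  shows "height R I = height R (Idl\<^bsub>R\<^esub> ((\<lambda>i. monomial (M i)) ` {2..q}))"
proof -
  let ?g = "\<lambda>i. monomial (M i) :: (nat, 'k) mpoly"
  let ?H = "\<lambda>i. polarization_support (M i)"
  interpret R: cring R unfolding R by (rule cring_poly_ring)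
  have carr: "?g ` {1..q} \<subseteq> carrier R" and I_eq: "I = Idl\<^bsub>R\<^esub> (?g ` {1..q})"
    using M by (auto simp: minimally_generates_def)
  have keys: "Poly_Mapping.keys (M i) \<subseteq> {1..n}" if "i \<in> {1..q}" for i
  proof -
    have "?g i \<in> carrier R" using carr that by blast
    then show ?thesis unfolding R by simp
  qed
  have anti: "i = j" if "i \<in> {1..q}" "j \<in> {1..q}" "M i = M j + c" for i j c
    using minimal_monomial_generators_antichain[OF M[unfolded R] that] .
  have facetsV: "\<Union> (facets \<Delta>) \<subseteq> V" and "finite V"
    using \<Delta>(1) by (auto simp: facets_def simplicial_complex_def)
  have HW: "?H i \<subseteq> W" if "i \<in> {1..q}" for i
    using enough_variables[OF that]
    by (simp add: S polarization_eq_facet_monomial facet_monomial_eq keys_squarefree_exponent)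
  have facets: "?H ` {1..q} = facets \<Delta>"
    by (rule polarization_supports_eq_facets[OF S(2) _ HW anti P[unfolded S]])
      (use facetsV \<Delta>(2) in auto)
  have H_inj: "i = j" if "i \<in> {1..q}" "j \<in> {1..q}" "?H i = ?H j" for i j
    using anti[OF that(1,2)] polarization_support_subset[of "M j" "M i"] that(3) by blast
  have F: "F \<in> facets \<Delta>" "G \<noteq> F" "F \<inter> G \<noteq> {}" "G \<in> facets \<Delta>"
    and F_int: "\<And>H. H \<in> facets \<Delta> \<Longrightarrow> H \<noteq> F \<Longrightarrow> F \<inter> H \<subseteq> G"
    using FG(2) by (auto simp: joint_def leaf_def)
  have "finite G" using F(4) facetsV \<open>finite V\<close> by (meson Union_upper finite_subset)
  then have G1: "G = ?H 1"
    using facet_monomial_inj[OF G[unfolded polarization_eq_facet_monomial]] by simp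
  obtain j where j: "j \<in> {1..q}" "F = ?H j"
    using F(1) facets by blast
  \<comment> \<open>The joint differs from its leaf, so the generator of the leaf is kept in the
    smaller ideal.\<close>
  have "j \<noteq> 1" using F(2) G1 j(2) by blast
  then have j2: "j \<in> {2..q}" using j(1) by auto
  \<comment> \<open>A common vertex of leaf and joint is some copy of a variable; its first
    component divides both monomials.\<close>
  obtain w where w: "w \<in> Poly_Mapping.keys (M 1)" "w \<in> Poly_Mapping.keys (M j)"
    using F(3) unfolding G1 j(2) by (auto simp: polarization_support_def)
  let ?I' = "Idl\<^bsub>R\<^esub> (?g ` {2..q})"
  have carr': "?g ` {2..q} \<subseteq> carrier R"
    using carr by auto
  have sub: "?I' \<subseteq> I"
    unfolding I_eq using R.genideal_self[OF carr]
    by (intro R.genideal_minimal R.genideal_ideal[OF carr]) auto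
  \<comment> \<open>Matching each prime over \<open>?I'\<close> with a prime over \<open>I\<close>
    of no greater height gives \<open>height R I \<le> height R ?I'\<close>; the reverse inequality
    is monotonicity along \<open>sub\<close>.\<close>
  have "\<exists>Q. primeideal Q R \<and> I \<subseteq> Q \<and> prime_height R Q \<le> prime_height R P"
    if P: "primeideal P R" "?I' \<subseteq> P" for P
  proof -
    have I_sub: "I \<subseteq> Q"
      if "primeideal Q R" "\<And>i. i \<in> {1..q} \<Longrightarrow> \<exists>u\<in>Poly_Mapping.keys (M i). var u \<in> Q" for Q
    proof -
      have "?g ` {1..q} \<subseteq> Q"
        using that monomial_in_primeideal[OF that(1)[unfolded R] keys] by blast
      then show ?thesis
        unfolding I_eq using that(1) by (intro R.genideal_minimal) (auto simp: primeideal_def)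
    qed
    have P_gen: "\<exists>u\<in>Poly_Mapping.keys (M i). var u \<in> P" if "i \<in> {2..q}" for i
    proof -
      have "?g i \<in> P" using R.genideal_self[OF carr'] P(2) that by blast
      then show ?thesis
        using monomial_in_primeideal[OF P(1)[unfolded R] keys[of i]] that by simp
    qed
    obtain v where v: "v \<in> Poly_Mapping.keys (M j)" "var v \<in> P"
      using P_gen[OF j2] by blast
    show ?thesis
    proof (cases "v \<in> Poly_Mapping.keys (M 1)")
      case True
      \<comment> \<open>\<open>v\<close> serves index 1, the only one that \<open>P_gen\<close>
        leaves open.\<close>
      have "\<exists>u\<in>Poly_Mapping.keys (M i). var u \<in> P" if "i \<in> {1..q}" for i
        using True v(2) P_gen[of i] that by (cases "i = 1") auto
      then show ?thesis using I_sub P(1) by blast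
    next
      case False
      \<comment> \<open>Otherwise \<open>(v, 1)\<close> would lie in the leaf and in another facet,
        hence in the joint, and \<open>v\<close> would divide \<open>M 1\<close>.\<close>
      have v_only: "v \<notin> Poly_Mapping.keys (M i)" if "i \<in> {1..q}" "i \<noteq> j" for i
      proof
        assume "v \<in> Poly_Mapping.keys (M i)"
        then have "(v, 1) \<in> F \<inter> ?H i"
          using v(1) unfolding j(2) Int_iff polarization_support_one by simp
        moreover have "?H i \<noteq> F" using H_inj[OF that(1) j(1)] that(2) j(2) by blast
        ultimately have "(v, 1) \<in> ?H 1"
          using F_int[of "?H i"] facets that(1) G1 by blast
        then show False using False unfolding polarization_support_one by simp
      qed
      \<comment> \<open>\<open>Q\<close> is \<open>P\<close> with the names \<open>v\<close> and
        \<open>w\<close> exchanged.\<close>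
      define Q where "Q = {x \<in> carrier R. swap_vars v w x \<in> P}"
      have vw: "v \<in> {1..n}" "w \<in> {1..n}" using v(1) w(2) keys[OF j(1)] by blast+
      have hom: "swap_vars v w \<in> ring_hom R R"
        unfolding R by (rule swap_vars_ring_hom[OF vw])
      have Q: "primeideal Q R" "prime_height R Q \<le> prime_height R P"
        unfolding Q_def
        using primeideal_vimage[OF R.is_cring R.is_cring hom P(1)]
          prime_height_vimage_involution[OF R.is_cring hom _ P(1)] by simp_all
      have var_Q: "var u \<in> Q" if "u \<in> {1..n}" "var (transpose v w u) \<in> P" for u
        using that by (simp add: Q_def swap_vars_var) (simp add: R var_def)
      \<comment> \<open>The swap sends \<open>w\<close> to \<open>v\<close>, and
        \<open>var v\<close> lies in \<open>P\<close>. This settles every generator divisible by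
        \<open>w\<close>, among them \<open>M 1\<close> and \<open>M j\<close>.\<close>
      have w_Q: "var w \<in> Q" using var_Q[OF vw(2)] v(2) by simp
      have "\<exists>u\<in>Poly_Mapping.keys (M i). var u \<in> Q" if i: "i \<in> {1..q}" for i
      proof (cases "w \<in> Poly_Mapping.keys (M i)")
        case w_notin: False
        \<comment> \<open>A generator without \<open>w\<close> belongs to \<open>?I'\<close> and is
          not the one of the leaf, so it avoids \<open>v\<close> too; the swap then fixes the
          variable \<open>u\<close> that \<open>P\<close> supplies.\<close>
        then have "i \<noteq> 1" "i \<noteq> j" using w by auto
        then obtain u where u: "u \<in> Poly_Mapping.keys (M i)" "var u \<in> P"
          using P_gen[of i] i by auto
        then have "u \<noteq> v" "u \<noteq> w" using v_only[OF i \<open>i \<noteq> j\<close>] w_notin by blast+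
        then have "var (transpose v w u) \<in> P" using u(2) by simp
        then show ?thesis using var_Q u(1) keys[OF i] by blast
      qed (use w_Q in blast)
      then show ?thesis using I_sub Q by blast
    qed
  qed
  then have "height R I \<le> height R ?I'"
    unfolding height_def by (intro Inf_mono) blast
  then show ?thesis using height_mono[OF sub] by (rule order_antisym)
qed

end
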